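(* Let $p$ be an odd prime. Then \[ \sum_{k=0}^{(p+1)/2} (-1)^k (4k-1)^3\frac{(-\frac{1}{2})_k^3}{k!^3} \equiv 3p(-1)^{(p-1)/2}\pmod{p^{2}}. \]
   Context: $(a)_k=a(a+1)\cdots(a+k-1)$ denotes the Pochhammer symbol, with $(a)_0=1$. The congruence between rational numbers is understood in the ring of rationals whose denominators are coprime to $p$. *)

theory Defs
  imports Complex_Main "HOL-Number_Theory.Cong"
begin

text \<open>The localization of the integers at \<open>p\<close>. The denominator returned by
  \<^const>\<open>quotient_of\<close> is that of the reduced fraction.\<close>

definition rats_coprime_denom :: "nat \<Rightarrow> rat set" where
  "rats_coprime_denom p = {x. coprime (snd (quotient_of x)) (int p)}"

text \<open>The library's \<^const>\<open>cong\<close> cannot be used here: divisibility in the field \<^typ>\<open>rat\<close>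
  is trivial, so the multiplier \<open>r\<close> has to be confined to the subring.\<close>

definition rat_cong :: "nat \<Rightarrow> rat \<Rightarrow> rat \<Rightarrow> nat \<Rightarrow> bool" where
  "rat_cong p a b m \<longleftrightarrow>
     a \<in> rats_coprime_denom p \<and> b \<in> rats_coprime_denom p \<and>
     (\<exists>r \<in> rats_coprime_denom p. a - b = of_nat m * r)"

end

theory Submission
  imports Defs
begin

text \<open>
  Put \<open>a = -1/2\<close>, \<open>b = -(1+p)/2\<close>, \<open>c = (p-1)/2\<close>. Replacing \<open>(a)\<^sub>k\<^sup>3 / k!\<^sup>3\<close> by the well-poised
  \<open>(a)\<^sub>k (b)\<^sub>k (c)\<^sub>k / (k! (1+a-b)\<^sub>k (1+a-c)\<^sub>k)\<close> changes each term only by a multiple of \<open>p\<^sup>2\<close>,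
  because the new expression is even in \<open>p\<close>. The deformed sum terminates and has an exact value:
  a telescoping sum shows that the weight \<open>(4k-1)\<^sup>3\<close> may be replaced by \<open>(4p\<^sup>2-3)(4k-1)\<close>,
  and with weight \<open>4k-1\<close> it is a terminating well-poised series at \<open>-1\<close>, summable by a
  Wilf--Zeilberger pair, with value \<open>p (-1)\<^bsup>(p+1)/2\<^esup>\<close>.
\<close>

section \<open>Two summation formulas\<close>

text \<open>Let R(k) be the right-hand side at k. In the k-th summand the product (a+k)(b+k)(c+k)
  extends each upper Pochhammer symbol by one factor and gives R(k). The product k(a-b+k)(a-c+k)
  cancels the last factor of each lower one and gives -R(k-1), or 0 when k = 0. If b is a
  nonpositive integer, R(m) vanishes for large m, which yields a linear relation between sums with
  different polynomial weights.\<close>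

lemma well_poised_telescope:
  fixes a b c :: "'a::field_char_0"
  assumes b: "\<And>k. 1 + a - b + of_nat k \<noteq> 0" and c: "\<And>k. 1 + a - c + of_nat k \<noteq> 0"
  shows "(\<Sum>k\<le>m. (-1) ^ k *
            ((a + of_nat k) * (b + of_nat k) * (c + of_nat k)
              + of_nat k * (a - b + of_nat k) * (a - c + of_nat k)) *
            (pochhammer a k * pochhammer b k * pochhammer c k /
              (fact k * pochhammer (1 + a - b) k * pochhammer (1 + a - c) k)))
         = (-1) ^ m * pochhammer a (Suc m) * pochhammer b (Suc m) * pochhammer c (Suc m) /
             (fact m * pochhammer (1 + a - b) m * pochhammer (1 + a - c) m)"
proof (induction m)
  case 0
  show ?case by simp
next
  case (Suc m)
  have nz: "pochhammer (1 + a - b) k \<noteq> 0" "pochhammer (1 + a - c) k \<noteq> 0" for k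
    using b c by (auto simp: pochhammer_eq_0_iff eq_neg_iff_add_eq_0 add.commute)
  define A where "A = pochhammer a (Suc m)"
  define B where "B = pochhammer b (Suc m)"
  define C where "C = pochhammer c (Suc m)"
  define D where "D = pochhammer (1 + a - b) m"
  define E where "E = pochhammer (1 + a - c) m"
  define F where "F = (fact m :: 'a)"
  define x where "x = (of_nat m :: 'a)"
  have nz': "D \<noteq> 0" "E \<noteq> 0" "F \<noteq> 0" "1 + a - b + x \<noteq> 0" "1 + a - c + x \<noteq> 0" "x + 1 \<noteq> 0"
    using nz b[of m] c[of m] of_nat_neq_0[of m]
    by (auto simp: D_def E_def F_def x_def add.commute)
  have eqs: "fact (Suc m) = (x + 1) * F" "pochhammer (1 + a - b) (Suc m) = D * (1 + a - b + x)"
    "pochhammer (1 + a - c) (Suc m) = E * (1 + a - c + x)" "of_nat (Suc m) = x + 1"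
    "pochhammer a (Suc (Suc m)) = A * (a + (x + 1))" "pochhammer b (Suc (Suc m)) = B * (b + (x + 1))"
    "pochhammer c (Suc (Suc m)) = C * (c + (x + 1))"
    by (simp_all add: A_def B_def C_def D_def E_def F_def x_def
        pochhammer_Suc[of _ "Suc m"] pochhammer_Suc[of _ m] add.commute)
  \<comment> \<open>\<open>K\<close> is the right-hand side at m. \<open>Z\<close> and
    \<open>w\<close> are the two products in the weight at m + 1, and \<open>w\<close> is also the
    factor by which the denominator grows, so the new term is -K(Z+w)/w.\<close>
  define K where "K = (-1) ^ m * A * B * C / (F * D * E)"
  define u v where "u = 1 + a - b + x" and "v = 1 + a - c + x"
  define w where "w = (x + 1) * u * v"
  define Z where "Z = (a + (x + 1)) * (b + (x + 1)) * (c + (x + 1))"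
  have w: "w \<noteq> 0" using nz' by (simp add: u_def v_def w_def)
  have Zw: "(a + (x + 1)) * (b + (x + 1)) * (c + (x + 1)) + (x + 1) * (a - b + (x + 1)) * (a - c + (x + 1))
      = Z + w"
    unfolding Z_def u_def v_def w_def by (simp add: algebra_simps)
  have "K + (-1) ^ Suc m * (Z + w) * (A * B * C / ((x + 1) * F * (D * u) * (E * v)))
      = K - K * ((Z + w) / w)"
    by (simp add: K_def w_def mult_ac)
  also have "\<dots> = - (K * (Z / w))"
    using w by (simp add: add_divide_distrib distrib_left)
  also have "\<dots> = (-1) ^ Suc m * (A * (a + (x + 1))) * (B * (b + (x + 1))) * (C * (c + (x + 1))) /
      ((x + 1) * F * (D * u) * (E * v))"
    by (simp add: K_def w_def Z_def mult_ac)
  finally show ?case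
    unfolding sum.atMost_Suc Suc.IH eqs A_def[symmetric] B_def[symmetric] C_def[symmetric]
      D_def[symmetric] E_def[symmetric] F_def[symmetric] u_def[symmetric] v_def[symmetric]
      Zw K_def .
qed

text \<open>The right-hand side is the Wilf--Zeilberger certificate; it vanishes for \<open>m > n\<close>.\<close>

lemma well_poised_summand_recurrence:
  fixes a c :: "'a::field_char_0"
  assumes a: "\<And>k. 1 + a + of_nat k \<noteq> 0" and c: "\<And>k. 1 + a - c + of_nat k \<noteq> 0"
  defines "t \<equiv> \<lambda>n k. (-1) ^ k * (a + 2 * of_nat k) *
             (pochhammer a k * pochhammer (- of_nat n) k * pochhammer c k /
              (fact k * pochhammer (1 + a + of_nat n) k * pochhammer (1 + a - c) k))"
  shows "(\<Sum>k\<le>m. (1 + a - c + of_nat n) * t (Suc n) k - (1 + a + of_nat n) * t n k)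
         = - (1 + a + of_nat n) * (-1) ^ m *
             (pochhammer a (Suc m) * pochhammer c (Suc m) * pochhammer (- of_nat n) m /
              (fact m * pochhammer (1 + a - c) m * pochhammer (1 + a + of_nat n) (Suc m)))"
proof (induction m)
  case 0
  show ?case using a[of n] by (simp add: t_def field_simps)
next
  case (Suc m)
  define y where "y = (of_nat n :: 'a)"
  define x where "x = (of_nat m :: 'a)"
  have nzp: "pochhammer (1 + a + y) k \<noteq> 0" "pochhammer (1 + a - c) k \<noteq> 0" for k
  proof -
    show "pochhammer (1 + a + y) k \<noteq> 0"
      using a[of "n + i" for i] unfolding y_def
      by (auto simp: pochhammer_eq_0_iff eq_neg_iff_add_eq_0 add.assoc)
    show "pochhammer (1 + a - c) k \<noteq> 0"
      using c by (auto simp: pochhammer_eq_0_iff eq_neg_iff_add_eq_0 add.commute)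
  qed
  define A where "A = pochhammer a (Suc m)"
  define C where "C = pochhammer c (Suc m)"
  define N where "N = pochhammer (- y) m"
  define E where "E = pochhammer (1 + a - c) m"
  define F where "F = (fact m :: 'a)"
  define P where "P = pochhammer (1 + a + y) (Suc m)"
  have nz: "E \<noteq> 0" "F \<noteq> 0" "P \<noteq> 0" "1 + a + y \<noteq> 0" "1 + a + y + x + 1 \<noteq> 0"
    "1 + a - c + x \<noteq> 0" "x + 1 \<noteq> 0"
    using nzp a[of n] a[of "n + m + 1"] c[of m] of_nat_neq_0[of m]
    by (auto simp: P_def E_def F_def x_def y_def algebra_simps)
  have eqs: "fact (Suc m) = (x + 1) * F" "pochhammer (1 + a - c) (Suc m) = E * (1 + a - c + x)"
    "of_nat (Suc m) = x + 1" "of_nat (Suc n) = y + 1"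
    "pochhammer a (Suc (Suc m)) = A * (a + (x + 1))"
    "pochhammer c (Suc (Suc m)) = C * (c + (x + 1))"
    "pochhammer (1 + a + y) (Suc (Suc m)) = P * (1 + a + y + x + 1)"
    "pochhammer (- y) (Suc m) = N * (x - y)"
    by (simp_all add: A_def C_def N_def E_def F_def P_def x_def y_def
        pochhammer_Suc[of _ "Suc m"] pochhammer_Suc[of _ m] add.commute add.left_commute)
  \<comment> \<open>Passing from n to n + 1 shifts the bases -n and 1 + a + n. Splitting off the
    first factor instead of the last expresses the shifted symbols through the same \<open>N\<close>
    and \<open>P\<close>.\<close>
  have N': "pochhammer (- (y + 1)) (Suc m) = - ((y + 1) * N)"
    unfolding N_def by (subst pochhammer_rec) (simp add: algebra_simps)
  have "pochhammer (1 + a + y) (Suc (Suc m)) = (1 + a + y) * pochhammer (1 + a + (y + 1)) (Suc m)"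
    by (subst pochhammer_rec) (simp add: algebra_simps)
  hence P': "pochhammer (1 + a + (y + 1)) (Suc m) = P * (1 + a + y + x + 1) / (1 + a + y)"
    unfolding eqs using nz(4) by (metis nonzero_mult_div_cancel_left)
  \<comment> \<open>Up to the factor -(1 + a + y), \<open>K\<close> is the certificate at m; both
    new terms are rational multiples of it.\<close>
  define K where "K = (-1) ^ m * A * C * N / (F * E * P)"
  define r s where "r = 1 + a - c + x" and "s = 1 + a + y + x + 1"
  have nz': "r \<noteq> 0" "s \<noteq> 0" using nz by (simp_all add: r_def s_def)
  have t: "t (Suc n) (Suc m) = K * ((a + 2 * (x + 1)) * (y + 1) * (1 + a + y) / ((x + 1) * r * s))"
    "t n (Suc m) = - K * ((a + 2 * (x + 1)) * (x - y) / ((x + 1) * r))"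
    unfolding t_def y_def[symmetric] unfolding eqs N' P' A_def[symmetric] C_def[symmetric]
      P_def[symmetric] r_def[symmetric] s_def[symmetric] K_def
    using nz nz' by (simp_all add: mult_ac)
  \<comment> \<open>Denominators are cleared over opaque variables. The instance has g = 1+a+y, d =
    1+a-c+y, M = a+2(x+1), e = y+1, z = x-y and W = (x+1)r.\<close>
  have combine: "- g * K + (d * (K * (M * e * g / (W * s))) - g * (- K * (M * z / W)))
      = K * g * ((- (W * s) + M * (d * e + z * s)) / (W * s))"
    if "W \<noteq> 0" "s \<noteq> 0" for g K d M e W s z :: 'a
    using that by (simp add: field_simps)
  have "(\<Sum>k\<le>Suc m. (1 + a - c + of_nat n) * t (Suc n) k - (1 + a + of_nat n) * t n k)
      = - (1 + a + y) * K + ((1 + a - c + y) * t (Suc n) (Suc m) - (1 + a + y) * t n (Suc m))"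
    unfolding sum.atMost_Suc Suc.IH
    by (simp add: K_def A_def C_def N_def E_def F_def P_def y_def mult_ac)
  also have "\<dots> = K * (1 + a + y) *
      ((- ((x + 1) * r * s) + (a + 2 * (x + 1)) * ((1 + a - c + y) * (y + 1) + (x - y) * s))
        / ((x + 1) * r * s))"
    unfolding t by (rule combine) (use nz nz' in auto)
  \<comment> \<open>This polynomial identity is the actual verification of the certificate: the
    numerator factors into exactly the new factors of its upper symbols.\<close>
  also have "- ((x + 1) * r * s) + (a + 2 * (x + 1)) * ((1 + a - c + y) * (y + 1) + (x - y) * s)
      = (a + (x + 1)) * (c + (x + 1)) * (x - y)"
    unfolding r_def s_def by algebra
  also have "K * (1 + a + y) * ((a + (x + 1)) * (c + (x + 1)) * (x - y) / ((x + 1) * r * s))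
      = - (1 + a + y) * (-1) ^ Suc m * (A * (a + (x + 1)) * (C * (c + (x + 1))) * (N * (x - y)) /
          ((x + 1) * F * (E * r) * (P * s)))"
    using nz nz' by (simp add: K_def mult_ac del: minus_add_distrib)
  finally show ?case
    unfolding y_def[symmetric] unfolding eqs r_def s_def .
qed

text \<open>After division by a, this is the classical well-poised 4F3 summation at -1 with b = -n,
  since (a+2k)/a = (1+a/2)_k / (a/2)_k. Both sides satisfy the same first-order recurrence in n:
  summed up to n + 1, the certificate contains (-n)_{n+1} = 0.\<close>

lemma well_poised_sum:
  fixes a c :: "'a::field_char_0"
  assumes a: "\<And>k. 1 + a + of_nat k \<noteq> 0" and c: "\<And>k. 1 + a - c + of_nat k \<noteq> 0"
  shows "(\<Sum>k\<le>n. (-1) ^ k * (a + 2 * of_nat k) *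
             (pochhammer a k * pochhammer (- of_nat n) k * pochhammer c k /
              (fact k * pochhammer (1 + a + of_nat n) k * pochhammer (1 + a - c) k)))
         = a * pochhammer (1 + a) n / pochhammer (1 + a - c) n"
proof (induction n)
  case 0
  show ?case by simp
next
  case (Suc n)
  define t where "t = (\<lambda>n k. (-1) ^ k * (a + 2 * of_nat k) *
             (pochhammer a k * pochhammer (- of_nat n) k * pochhammer c k /
              (fact k * pochhammer (1 + a + of_nat n) k * pochhammer (1 + a - c) k)))"
  have z: "pochhammer (- of_nat n :: 'a) (Suc n) = 0"
    by (auto simp: pochhammer_eq_0_iff)
  have "(\<Sum>k\<le>Suc n. (1 + a - c + of_nat n) * t (Suc n) k - (1 + a + of_nat n) * t n k) = 0"
    unfolding t_def well_poised_summand_recurrence[OF a c] z by simp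
  \<comment> \<open>Hence the sum of \<open>t n\<close> may stop at n, where the induction
    hypothesis applies.\<close>
  moreover have "t n (Suc n) = 0"
    unfolding t_def z by simp
  ultimately have "(1 + a - c + of_nat n) * (\<Sum>k\<le>Suc n. t (Suc n) k)
      = (1 + a + of_nat n) * (\<Sum>k\<le>n. t n k)"
    unfolding sum_subtractf sum_distrib_left[symmetric] sum.atMost_Suc[of "t n"] by simp
  also have "(\<Sum>k\<le>n. t n k) = a * pochhammer (1 + a) n / pochhammer (1 + a - c) n"
    using Suc.IH unfolding t_def .
  finally have "(\<Sum>k\<le>Suc n. t (Suc n) k)
      = (1 + a + of_nat n) * (a * pochhammer (1 + a) n / pochhammer (1 + a - c) n)
          / (1 + a - c + of_nat n)"
    using c[of n] by (metis nonzero_mult_div_cancel_left)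
  hence "(\<Sum>k\<le>Suc n. t (Suc n) k)
      = a * pochhammer (1 + a) (Suc n) / pochhammer (1 + a - c) (Suc n)"
    by (simp add: pochhammer_Suc mult_ac)
  thus ?case unfolding t_def .
qed

section \<open>Rationals with denominator coprime to \<open>p\<close>\<close>

text \<open>The reduced denominator divides the denominator of any other representation, so any
  fraction may serve as a witness. The closure properties then follow without reducing
  fractions.\<close>

lemma rats_coprime_denom_iff:
  "x \<in> rats_coprime_denom p \<longleftrightarrow> (\<exists>u v. v \<noteq> 0 \<and> coprime v (int p) \<and> x = of_int u / of_int v)"
proof
  assume "x \<in> rats_coprime_denom p"
  moreover obtain u v where uv: "quotient_of x = (u, v)" by fastforce
  ultimately show "\<exists>u v. v \<noteq> 0 \<and> coprime v (int p) \<and> x = of_int u / of_int v"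
    using quotient_of_div[OF uv] quotient_of_denom_pos[OF uv]
    by (intro exI[of _ u] exI[of _ v]) (auto simp: rats_coprime_denom_def)
next
  assume "\<exists>u v. v \<noteq> 0 \<and> coprime v (int p) \<and> x = of_int u / of_int v"
  then obtain u v where v: "v \<noteq> 0" "coprime v (int p)" and x: "x = of_int u / of_int v" by blast
  obtain r s where rs: "quotient_of x = (r, s)" by fastforce
  have s: "s > 0" "coprime r s" "x = of_int r / of_int s"
    using quotient_of_denom_pos[OF rs] quotient_of_coprime[OF rs] quotient_of_div[OF rs] by auto
  have "of_int (u * s) = (of_int (r * v) :: rat)"
    using s(1) v(1) x s(3) by (simp add: field_simps)
  hence "u * s = r * v" by (simp only: of_int_eq_iff)
  hence "s dvd r * v" by (metis dvd_triv_right)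
  hence "s dvd v" using s(2) by (simp add: coprime_commute coprime_dvd_mult_right_iff)
  hence "coprime s (int p)" using v(2) coprime_divisors[OF _ dvd_refl] by blast
  thus "x \<in> rats_coprime_denom p" by (simp add: rats_coprime_denom_def rs)
qed

lemma rats_coprime_denom_of_int [simp]: "of_int u \<in> rats_coprime_denom p"
  unfolding rats_coprime_denom_iff by (intro exI[of _ u] exI[of _ 1]) simp

lemma rats_coprime_denom_of_nat [simp]: "of_nat u \<in> rats_coprime_denom p"
  using rats_coprime_denom_of_int[of "int u"] by simp

lemma rats_coprime_denom_numeral [simp]:
  "0 \<in> rats_coprime_denom p" "1 \<in> rats_coprime_denom p" "numeral w \<in> rats_coprime_denom p"
  using rats_coprime_denom_of_int[of 0] rats_coprime_denom_of_int[of 1]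
    rats_coprime_denom_of_int[of "numeral w"] by simp_all

lemma rats_coprime_denom_add [intro]:
  assumes "x \<in> rats_coprime_denom p" "y \<in> rats_coprime_denom p"
  shows "x + y \<in> rats_coprime_denom p"
proof -
  from assms obtain u v u' v' where "v \<noteq> 0" "coprime v (int p)" "x = of_int u / of_int v"
    "v' \<noteq> 0" "coprime v' (int p)" "y = of_int u' / of_int v'"
    unfolding rats_coprime_denom_iff by blast
  thus ?thesis unfolding rats_coprime_denom_iff
    by (intro exI[of _ "u * v' + u' * v"] exI[of _ "v * v'"]) (auto simp: field_simps)
qed

lemma rats_coprime_denom_mult [intro]:
  assumes "x \<in> rats_coprime_denom p" "y \<in> rats_coprime_denom p"
  shows "x * y \<in> rats_coprime_denom p"
proof -
  from assms obtain u v u' v' where "v \<noteq> 0" "coprime v (int p)" "x = of_int u / of_int v"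
    "v' \<noteq> 0" "coprime v' (int p)" "y = of_int u' / of_int v'"
    unfolding rats_coprime_denom_iff by blast
  thus ?thesis unfolding rats_coprime_denom_iff
    by (intro exI[of _ "u * u'"] exI[of _ "v * v'"]) auto
qed

lemma rats_coprime_denom_uminus [intro]:
  "x \<in> rats_coprime_denom p \<Longrightarrow> - x \<in> rats_coprime_denom p"
  using rats_coprime_denom_mult[OF rats_coprime_denom_of_int[of "-1"], of x p] by simp

lemma rats_coprime_denom_diff [intro]:
  "x \<in> rats_coprime_denom p \<Longrightarrow> y \<in> rats_coprime_denom p \<Longrightarrow> x - y \<in> rats_coprime_denom p"
  using rats_coprime_denom_add[OF _ rats_coprime_denom_uminus, of x p y] by simp

lemma rats_coprime_denom_power [intro]:
  "x \<in> rats_coprime_denom p \<Longrightarrow> x ^ k \<in> rats_coprime_denom p"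
  by (induction k) auto

lemma rats_coprime_denom_divide:
  assumes "x \<in> rats_coprime_denom p" "coprime v (int p)"
  shows "x / of_int v \<in> rats_coprime_denom p"
\<comment> \<open>Division by zero yields 0, which lies in the ring.\<close>
proof (cases "v = 0")
  case False
  hence "1 / of_int v \<in> rats_coprime_denom p"
    unfolding rats_coprime_denom_iff using assms by (intro exI[of _ 1] exI[of _ v]) auto
  from rats_coprime_denom_mult[OF assms(1) this] show ?thesis by simp
qed simp

section \<open>Congruence arithmetic in the localization at \<open>p\<close>\<close>

lemma rat_cong_refl: "x \<in> rats_coprime_denom p \<Longrightarrow> rat_cong p x x m"
  unfolding rat_cong_def by (auto intro!: bexI[of _ 0])

lemma rat_cong_add:
  assumes "rat_cong p x y m" "rat_cong p x' y' m"
  shows "rat_cong p (x + x') (y + y') m"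
proof -
  from assms obtain r r' where "r \<in> rats_coprime_denom p" "r' \<in> rats_coprime_denom p"
    "x - y = of_nat m * r" "x' - y' = of_nat m * r'"
    unfolding rat_cong_def by blast
  moreover from this have "x + x' - (y + y') = of_nat m * (r + r')"
    by (simp add: algebra_simps)
  ultimately show ?thesis using assms unfolding rat_cong_def by blast
qed

lemma rat_cong_mult:
  assumes "rat_cong p x y m" "rat_cong p x' y' m"
  shows "rat_cong p (x * x') (y * y') m"
proof -
  from assms obtain r r' where r: "r \<in> rats_coprime_denom p" "r' \<in> rats_coprime_denom p"
    "x - y = of_nat m * r" "x' - y' = of_nat m * r'"
    unfolding rat_cong_def by blast
  have "x * x' - y * y' = (x - y) * x' + y * (x' - y')" by (simp add: algebra_simps)
  also have "\<dots> = of_nat m * (r * x' + y * r')" unfolding r by (simp add: algebra_simps)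
  finally show ?thesis using assms r unfolding rat_cong_def
    by (auto intro!: bexI[of _ "r * x' + y * r'"])
qed

lemma rat_cong_sum:
  "(\<And>k. k \<in> A \<Longrightarrow> rat_cong p (f k) (g k) m) \<Longrightarrow> rat_cong p (sum f A) (sum g A) m"
  by (induction A rule: infinite_finite_induct) (auto intro: rat_cong_add rat_cong_refl)

lemma rat_cong_trans:
  assumes "rat_cong p x y m" "rat_cong p y z m"
  shows "rat_cong p x z m"
proof -
  from assms obtain r r' where "r \<in> rats_coprime_denom p" "r' \<in> rats_coprime_denom p"
    "x - y = of_nat m * r" "y - z = of_nat m * r'"
    unfolding rat_cong_def by blast
  moreover from this have "x - z = of_nat m * (r + r')"
    by (simp add: algebra_simps)
  ultimately show ?thesis using assms unfolding rat_cong_def by blast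
qed

section \<open>The congruence\<close>

text \<open>An exact rational identity for every odd \<open>q\<close>. Here b = -(h+1) makes the
  series stop at k = h + 1, while the bases in the denominators are half-integers and never reach
  zero.\<close>

lemma deformed_sum:
  fixes h :: nat
  defines "q \<equiv> of_nat (2 * h + 1) :: rat"
  shows "(\<Sum>k\<le>Suc h. (-1) ^ k * (4 * of_nat k - 1) ^ 3 *
           (pochhammer (-1/2) k * pochhammer (-1/2 - q/2) k * pochhammer (-1/2 + q/2) k /
            (fact k * pochhammer (1 + q/2) k * pochhammer (1 - q/2) k)))
         = (3 * q - 4 * q ^ 3) * (-1) ^ h"
proof -
  have q: "q = 2 * of_nat h + 1" by (simp add: q_def)
  define a b c :: rat where "a = -1/2" and "b = - of_nat (Suc h)" and "c = of_nat h"
  define T where "T = (\<lambda>k. pochhammer a k * pochhammer b k * pochhammer c k /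
            (fact k * pochhammer (1 + a - b) k * pochhammer (1 + a - c) k))"
  \<comment> \<open>Doubling turns each quantity into an odd integer, hence a nonzero one.\<close>
  have "2 * (1 + a + of_nat k) = of_int (2 * int k + 1)"
    "2 * (1 + a - b + of_nat k) = of_int (2 * int k + 2 * int h + 3)"
    "2 * (1 + a - c + of_nat k) = of_int (2 * int k + 1 - 2 * int h)" for k
    by (simp_all add: a_def b_def c_def algebra_simps)
  moreover have "of_int (2 * int k + 1) \<noteq> (0::rat)"
    "of_int (2 * int k + 2 * int h + 3) \<noteq> (0::rat)"
    "of_int (2 * int k + 1 - 2 * int h) \<noteq> (0::rat)" for k
    unfolding of_int_eq_0_iff by presburger+
  ultimately have nz: "1 + a + of_nat k \<noteq> 0" "1 + a - b + of_nat k \<noteq> 0"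
    "1 + a - c + of_nat k \<noteq> 0" for k
    by (metis mult_zero_right)+
  have z: "pochhammer b (Suc (Suc h)) = 0"
    unfolding b_def pochhammer_eq_0_iff by blast
  have eqs: "b = -1/2 - q/2" "c = -1/2 + q/2" "1 + a - b = 1 + q/2" "1 + a - c = 1 - q/2"
    by (simp_all add: a_def b_def c_def q field_simps)
  define S1 where "S1 = (\<Sum>k\<le>Suc h. (-1) ^ k * (4 * of_nat k - 1) * T k)"
  define S3 where "S3 = (\<Sum>k\<le>Suc h. (-1) ^ k * (4 * of_nat k - 1) ^ 3 * T k)"
  have "0 = (\<Sum>k\<le>Suc h. (-1) ^ k *
            ((a + of_nat k) * (b + of_nat k) * (c + of_nat k)
              + of_nat k * (a - b + of_nat k) * (a - c + of_nat k)) * T k)"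
    unfolding T_def well_poised_telescope[OF nz(2,3)] z by simp
  \<comment> \<open>With x = 4k - 1 the weight is ((x-1)^3 + (x+1)^3)/64 - q^2 x/8 = (x^3 + (3 -
    4q^2)x)/32, so the vanishing sum expresses \<open>S3\<close> through \<open>S1\<close>.\<close>
  also have "\<dots> = (\<Sum>k\<le>Suc h. ((-1) ^ k * (4 * of_nat k - 1) ^ 3 * T k
                 + (3 - 4 * q ^ 2) * ((-1) ^ k * (4 * of_nat k - 1) * T k)) / 32)"
    by (intro sum.cong refl)
      (simp add: a_def b_def c_def q field_simps power2_eq_square power3_eq_cube)
  also have "\<dots> = (S3 + (3 - 4 * q ^ 2) * S1) / 32"
    unfolding S1_def S3_def by (simp only: sum_divide_distrib[symmetric] sum.distrib sum_distrib_left)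
  finally have S3: "S3 = (4 * q ^ 2 - 3) * S1" by (simp add: algebra_simps)
  have "S1 = 2 * (\<Sum>k\<le>Suc h. (-1) ^ k * (a + 2 * of_nat k) * T k)"
    unfolding S1_def sum_distrib_left
    by (intro sum.cong refl) (simp add: a_def algebra_simps)
  also have "(\<Sum>k\<le>Suc h. (-1) ^ k * (a + 2 * of_nat k) * T k)
      = a * pochhammer (1 + a) (Suc h) / pochhammer (1 + a - c) (Suc h)"
    using well_poised_sum[OF nz(1,3), of "Suc h"] unfolding T_def b_def by simp
  \<comment> \<open>The factors 1/2-h, ..., 1/2 are those of \<open>pochhammer a (Suc h)\<close>
    negated and in reverse order, so that symbol cancels from the quotient.\<close>
  also have "pochhammer (1 + a - c) (Suc h) = (-1) ^ Suc h * pochhammer a (Suc h)"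
    using pochhammer_minus[of "-a" "Suc h"] by (simp add: a_def c_def algebra_simps)
  also have "a * pochhammer (1 + a) (Suc h) = pochhammer a (Suc h) * (a + of_nat (Suc h))"
    using pochhammer_rec[of a "Suc h"] pochhammer_Suc[of a "Suc h"] by (simp add: add.commute)
  finally have "S1 = 2 * (pochhammer a (Suc h) * (a + of_nat (Suc h))
      / ((-1) ^ Suc h * pochhammer a (Suc h)))" .
  moreover have "pochhammer a (Suc h) \<noteq> 0"
  proof -
    have "a \<noteq> - of_nat k" for k
    proof
      assume "a = - of_nat k"
      hence "of_nat (2 * k) = (of_nat 1 :: rat)" by (simp add: a_def)
      thus False unfolding of_nat_eq_iff by presburger
    qed
    thus ?thesis unfolding pochhammer_eq_0_iff by blast
  qed
  ultimately have "S1 = 2 * ((a + of_nat (Suc h)) / (-1) ^ Suc h)" by simp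
  hence "S1 = - q * (-1) ^ h"
    by (cases "even h") (auto simp: q a_def field_simps)
  hence "S3 = (3 * q - 4 * q ^ 3) * (-1) ^ h"
    unfolding S3 by (simp add: algebra_simps power2_eq_square power3_eq_cube)
  \<comment> \<open>The denominator bases are rewritten first, while \<open>b\<close> and
    \<open>c\<close> still occur in them by name.\<close>
  thus ?thesis unfolding S3_def T_def eqs(3,4) unfolding eqs(1,2) unfolding a_def .
qed

section \<open>Coprimality to \<open>p\<close> and the termwise congruence\<close>

lemma coprime_less_prime:
  fixes p :: nat
  assumes "prime p" "0 < k" "k < p"
  shows "coprime (int k) (int p)"
proof -
  have "coprime k p"
    using assms by (metis coprime_commute dvd_imp_le not_le prime_imp_coprime)
  thus ?thesis by simp
qed

lemma coprime_fact_prime: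
  fixes p :: nat
  assumes "prime p" "k < p"
  shows "coprime (fact k :: int) (int p)"
  using assms(2)
proof (induction k)
  case (Suc k)
  with coprime_less_prime[OF assms(1), of "Suc k"] show ?case
    by (simp add: coprime_mult_left_iff)
qed simp

text \<open>Induction on k by the ratios of consecutive terms. With u = 2(k+1) and v = 2k-1 these
  are v^2/u^2 and (v^2-p^2)/(u^2-p^2), whose difference is p^2 (u^2-v^2)/(u^2 (u^2-p^2)). The bound
  k < p keeps u, and so both denominators, coprime to p.\<close>

lemma deformed_term_cong:
  fixes p :: nat
  assumes "prime p" "odd p" "k < p"
  shows "rat_cong p (pochhammer (-1/2) k ^ 2 / fact k ^ 2)
    (pochhammer (-1/2 - of_nat p/2) k * pochhammer (-1/2 + of_nat p/2) k /
      (pochhammer (1 + of_nat p/2) k * pochhammer (1 - of_nat p/2) k)) (p ^ 2)"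
  using assms(3)
proof (induction k)
  case 0
  show ?case by (simp add: rat_cong_refl)
next
  case (Suc k)
  define u v where "u = 2 * int (Suc k)" and "v = 2 * int k - 1"
  define r s :: rat where "r = of_int (v ^ 2) / of_int (u ^ 2)"
    and "s = of_int (v ^ 2 - int p ^ 2) / of_int (u ^ 2 - int p ^ 2)"
  have "coprime (int (Suc k)) (int p)"
    using coprime_less_prime[OF assms(1)] Suc.prems by blast
  moreover have "coprime 2 (int p)" using assms(2) by simp
  ultimately have "coprime u (int p)" unfolding u_def coprime_mult_left_iff by blast
  hence cu: "coprime (u ^ 2) (int p)" by simp
  hence cu': "coprime (u ^ 2 - int p ^ 2) (int p)"
    using gcd_add_mult[of "int p" "- int p" "u ^ 2"]
    by (simp add: coprime_iff_gcd_eq_1 gcd.commute power2_eq_square)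
  \<comment> \<open>Since u is even and p odd, parity excludes a zero denominator.\<close>
  have "odd (u ^ 2 - int p ^ 2)" using assms(2) by (simp add: u_def)
  hence u0: "u ^ 2 - int p ^ 2 \<noteq> 0" "u \<noteq> 0" by (metis even_zero) (simp add: u_def)
  have u0': "of_int u ^ 2 - of_nat p ^ 2 \<noteq> (0::rat)"
  proof -
    have "of_int (u ^ 2 - int p ^ 2) \<noteq> (0::rat)" using u0(1) by (simp only: of_int_eq_0_iff) simp
    thus ?thesis by simp
  qed
  have "r - s = of_nat (p ^ 2) * (of_int (u ^ 2 - v ^ 2) / of_int (u ^ 2 * (u ^ 2 - int p ^ 2)))"
    using u0 u0' unfolding r_def s_def by (simp add: field_simps)
  moreover have "of_int (u ^ 2 - v ^ 2) / of_int (u ^ 2 * (u ^ 2 - int p ^ 2))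
      \<in> rats_coprime_denom p"
    using cu cu' by (intro rats_coprime_denom_divide rats_coprime_denom_of_int)
      (simp only: coprime_mult_left_iff)
  ultimately have rs: "rat_cong p r s (p ^ 2)"
    using cu cu' unfolding rat_cong_def
    by (auto simp only: r_def s_def intro!: rats_coprime_denom_divide rats_coprime_denom_of_int)
  have r: "r = (-1/2 + of_nat k) ^ 2 / (1 + of_nat k) ^ 2"
    unfolding r_def u_def v_def by (simp add: field_simps power2_eq_square)
  have s: "s = ((-1/2 - of_nat p/2 + of_nat k) * (-1/2 + of_nat p/2 + of_nat k)) /
      ((1 + of_nat p/2 + of_nat k) * (1 - of_nat p/2 + of_nat k))" (is "_ = ?N / ?D")
  proof -
    have "of_int (v ^ 2 - int p ^ 2) = 4 * ?N" "of_int (u ^ 2 - int p ^ 2) = 4 * ?D"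
      unfolding u_def v_def by (simp_all add: field_simps power2_eq_square)
    thus ?thesis unfolding s_def by simp
  qed
  show ?case
    using rat_cong_mult[OF Suc.IH rs] Suc.prems unfolding r s
    by (simp add: pochhammer_Suc power_mult_distrib mult_ac)
qed

lemma pochhammer_minus_half_in_rats_coprime_denom:
  assumes "odd p"
  shows "pochhammer (-1/2) k \<in> rats_coprime_denom p"
proof -
  have half: "-1/2 \<in> rats_coprime_denom p"
    using rats_coprime_denom_divide[of "-1" p 2] rats_coprime_denom_of_int[of "-1" p] assms by simp
  show ?thesis
  proof (induction k)
    case (Suc k)
    show ?case unfolding pochhammer_Suc
      by (intro rats_coprime_denom_mult rats_coprime_denom_add Suc half rats_coprime_denom_of_nat)
  qed simp
qed

theorem theorem1p2:
  fixes p :: nat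
  assumes "prime p" and "odd p"
  shows "rat_cong p
    (\<Sum>k = 0..(p + 1) div 2.
       (-1) ^ k * (4 * of_nat k - 1) ^ 3 * (pochhammer (- 1 / 2) k ^ 3 / fact k ^ 3))
    (3 * of_nat p * (-1) ^ ((p - 1) div 2))
    (p ^ 2)"
proof -
  obtain h where p: "p = 2 * h + 1" using assms(2) by (elim oddE)
  \<comment> \<open>This gives h + 1 < p, so every index of the sum satisfies k < p.\<close>
  have h: "h > 0" using p assms(1) by (cases h) auto
  define q where "q = (of_nat p :: rat)"
  let ?w = "\<lambda>k. (-1) ^ k * (4 * of_nat k - 1) ^ 3 :: rat"
  \<comment> \<open>One factor (-1/2)_k / k! of the cube stays as it is; only the remaining square
    is deformed.\<close>
  have "rat_cong p
      (\<Sum>k\<le>Suc h. ?w k * (pochhammer (- 1 / 2) k / fact k) * (pochhammer (-1/2) k ^ 2 / fact k ^ 2))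
      (\<Sum>k\<le>Suc h. ?w k * (pochhammer (- 1 / 2) k / fact k) *
        (pochhammer (-1/2 - q/2) k * pochhammer (-1/2 + q/2) k /
          (pochhammer (1 + q/2) k * pochhammer (1 - q/2) k))) (p ^ 2)"
  proof (intro rat_cong_sum rat_cong_mult)
    fix k assume "k \<in> {..Suc h}"
    hence k: "k < p" using p h by auto
    show "rat_cong p (pochhammer (-1/2) k ^ 2 / fact k ^ 2)
        (pochhammer (-1/2 - q/2) k * pochhammer (-1/2 + q/2) k /
          (pochhammer (1 + q/2) k * pochhammer (1 - q/2) k)) (p ^ 2)"
      unfolding q_def by (rule deformed_term_cong[OF assms k])
    have "pochhammer (-1/2) k / of_int (fact k) \<in> rats_coprime_denom p"
      by (intro rats_coprime_denom_divide pochhammer_minus_half_in_rats_coprime_denom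
          coprime_fact_prime assms k)
    thus "rat_cong p (pochhammer (-1/2) k / fact k) (pochhammer (-1/2) k / fact k) (p ^ 2)"
      by (intro rat_cong_refl) simp
    show "rat_cong p ((4 * of_nat k - 1) ^ 3) ((4 * of_nat k - 1) ^ 3) (p ^ 2)"
      by (intro rat_cong_refl rats_coprime_denom_power rats_coprime_denom_diff
          rats_coprime_denom_mult) simp_all
    show "rat_cong p ((-1) ^ k) ((-1) ^ k) (p ^ 2)"
      by (intro rat_cong_refl rats_coprime_denom_power rats_coprime_denom_uminus) simp
  qed
  also have "(\<Sum>k\<le>Suc h. ?w k * (pochhammer (- 1 / 2) k / fact k) *
        (pochhammer (-1/2 - q/2) k * pochhammer (-1/2 + q/2) k /
          (pochhammer (1 + q/2) k * pochhammer (1 - q/2) k))) = (3 * q - 4 * q ^ 3) * (-1) ^ h"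
    using deformed_sum[of h] unfolding p q_def by (simp add: mult.assoc)
  finally have "rat_cong p
      (\<Sum>k\<le>Suc h. ?w k * (pochhammer (- 1 / 2) k / fact k) * (pochhammer (-1/2) k ^ 2 / fact k ^ 2))
      ((3 * q - 4 * q ^ 3) * (-1) ^ h) (p ^ 2)" .
  \<comment> \<open>As q = p, the term 4q^3 is p^2 times 4q, which determines the
    multiplier.\<close>
  moreover have "rat_cong p ((3 * q - 4 * q ^ 3) * (-1) ^ h) (3 * q * (-1) ^ h) (p ^ 2)"
    unfolding rat_cong_def
  proof (intro conjI bexI[of _ "- (4 * q * (-1) ^ h)"])
    show "(3 * q - 4 * q ^ 3) * (-1) ^ h - 3 * q * (-1) ^ h = of_nat (p ^ 2) * - (4 * q * (-1) ^ h)"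
      by (simp add: q_def algebra_simps power2_eq_square power3_eq_cube)
  qed (unfold q_def, (intro rats_coprime_denom_mult rats_coprime_denom_diff rats_coprime_denom_power
      rats_coprime_denom_uminus rats_coprime_denom_of_nat rats_coprime_denom_numeral)+)
  ultimately have "rat_cong p
      (\<Sum>k\<le>Suc h. ?w k * (pochhammer (- 1 / 2) k / fact k) * (pochhammer (-1/2) k ^ 2 / fact k ^ 2))
      (3 * q * (-1) ^ h) (p ^ 2)"
    by (rule rat_cong_trans)
  moreover have "(p + 1) div 2 = Suc h" "(p - 1) div 2 = h" using p by auto
  ultimately show ?thesis
    by (simp add: q_def atLeast0AtMost power2_eq_square power3_eq_cube mult.assoc del: sum.atMost_Suc)
qed

end
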